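(* Let $\mathcal{A}$ be any online algorithm for the auto-bidding problem described in the context that strictly satisfies the return-on-spend constraint (ROSC), i.e. $\mathbb{E}\{\sum_{t=1}^T p_t(b_t)\}\le \mathbb{E}\{\sum_{t=1}^T v_t x_t(b_t)\}$. Then its regret satisfies $\mathcal{R}_{\mathcal{A}}(T)=\Omega(T)$.
   Context: Auto-bidding problem over a horizon of $T$ slots. In each slot $t=1,\dots,T$ a triple $(v_t,x_t,p_t)$ is drawn i.i.d. from a distribution $\mathcal{D}$ unknown to the algorithm. Here $v_t\in[0,1]$ is the value; $x_t:[0,\infty)\to[0,1]$ is the allocation function, non-decreasing in the bid with $x_t(0)=0$ ($x_t(b)$ is the probability of winning slot $t$ with bid $b$); $p_t(b)=q_t(b)x_t(b)$ is the expected payment function, where $q_t:[0,\infty)\to[0,1]$ is non-decreasing, is zero when the allocation is zero, and is at most the bid (so $p_t(v_t)\le v_t x_t(v_t)$). An online algorithm chooses, in slot $t$, a bid $b_t\ge 0$ (possibly randomized) knowing only $v_t$ and the past $(v_\tau,x_\tau(b_\tau),p_\tau(b_\tau))_{\tau<t}$; after bidding, $x_t(b_t)$ and $p_t(b_t)$ are revealed. The problem is to maximize $V(T)=\mathbb{E}\{\sum_{t=1}^T v_t x_t(b_t)\}$ subject to the ROSC: $\mathbb{E}\{\sum_{t=1}^T p_t(b_t)\}\le\mathbb{E}\{\sum_{t=1}^T v_t x_t(b_t)\}$. An algorithm strictly satisfies the ROSC if this inequality holds for whatever $\mathcal{D}$ generates the input. The benchmark $\mathsf{OPT}$ solves this constrained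 maximization problem knowing the distribution $\mathcal{D}$ (but not the realizations in advance). The regret of $\mathcal{A}$ is $\mathcal{R}_{\mathcal{A}}(T)=\max_{\mathcal{D}}\left(V_{\mathsf{OPT}}(T)-V_{\mathcal{A}}(T)\right)$, the maximum being over all distributions $\mathcal{D}$ of $(v_t,x_t,p_t)$ ($\mathcal{D}$ may depend on $T$). *)

theory Defs
  imports "HOL-Probability.Probability" "HOL-Library.Landau_Symbols"
begin

section \<open>Auction slots and input distributions\<close>

text \<open>A slot is a triple \<open>(v, x, p)\<close>: value, allocation function, expected payment function.
  The functions are total on the reals, but only their restrictions to bids \<open>b \<ge> 0\<close> matter.\<close>

type_synonym slot = "real \<times> (real \<Rightarrow> real) \<times> (real \<Rightarrow> real)"

definition slot_value :: "slot \<Rightarrow> real" where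
  "slot_value s = fst s"

definition alloc :: "slot \<Rightarrow> real \<Rightarrow> real" where
  "alloc s = fst (snd s)"

definition payment :: "slot \<Rightarrow> real \<Rightarrow> real" where
  "payment s = snd (snd s)"

definition valid_slot :: "slot \<Rightarrow> bool" where
  "valid_slot s \<longleftrightarrow>
     slot_value s \<in> {0..1} \<and>
     alloc s \<in> {0..} \<rightarrow> {0..1} \<and> mono_on {0..} (alloc s) \<and> alloc s 0 = 0 \<and>
     (\<exists>q. q \<in> {0..} \<rightarrow> {0..1} \<and> mono_on {0..} q \<and>
          (\<forall>b\<ge>0. alloc s b = 0 \<longrightarrow> q b = 0) \<and>
          (\<forall>b\<ge>0. q b \<le> b) \<and>
          (\<forall>b\<ge>0. payment s b = q b * alloc s b))"

definition nonneg_bids :: "real measure" where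
  "nonneg_bids = restrict_space borel {0..}"

text \<open>The function space carries no canonical \<open>\<sigma>\<close>-algebra, so a distribution brings its own.  It
  only has to make the value measurable and the allocation and the payment jointly measurable
  in slot and bid; joint measurability does not follow from monotonicity in the bid, and it is what
  makes \<open>x\<^sub>t(b\<^sub>t)\<close> and \<open>p\<^sub>t(b\<^sub>t)\<close> random variables when the bid itself is random.\<close>

definition input_distributions :: "slot measure set" where
  "input_distributions =
     {D. prob_space D \<and> (\<forall>s\<in>space D. valid_slot s) \<and>
         slot_value \<in> borel_measurable D \<and>
         (\<lambda>(s, b). alloc s b) \<in> borel_measurable (D \<Otimes>\<^sub>M nonneg_bids) \<and>
         (\<lambda>(s, b). payment s b) \<in> borel_measurable (D \<Otimes>\<^sub>M nonneg_bids)}"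


section \<open>Online algorithms\<close>

text \<open>Slots are numbered from \<open>0\<close>.  What is known of a past slot \<open>\<tau>\<close> is the triple
  \<open>(v\<^sub>\<tau>, x\<^sub>\<tau>(b\<^sub>\<tau>), p\<^sub>\<tau>(b\<^sub>\<tau>))\<close>; a history before slot \<open>t\<close> is an element of the product space over
  \<open>{..<t}\<close>, that is, a function that is \<open>undefined\<close> from \<open>t\<close> on.\<close>

type_synonym history = "nat \<Rightarrow> real \<times> real \<times> real"

definition history_space :: "nat \<Rightarrow> history measure" where
  "history_space t = (\<Pi>\<^sub>M \<tau>\<in>{..<t}. borel)"

text \<open>A randomized algorithm is a law for a real random seed, drawn once and independently of the
  input, together with a policy \<open>\<pi> t r h v\<close> giving the bid in slot \<open>t\<close> for seed \<open>r\<close>, history \<open>h\<close> and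
  current value \<open>v\<close>.  A real seed can encode a sequence of independent random choices, and the
  algorithm's own past bids are determined by its seed and history.\<close>

type_synonym bidder = "real measure \<times> (nat \<Rightarrow> real \<Rightarrow> history \<Rightarrow> real \<Rightarrow> real)"

definition online_algorithms :: "bidder set" where
  "online_algorithms =
     {(R, \<pi>). prob_space R \<and> sets R = sets borel \<and>
        (\<forall>t. (\<lambda>(r, h, v). \<pi> t r h v) \<in> R \<Otimes>\<^sub>M history_space t \<Otimes>\<^sub>M borel \<rightarrow>\<^sub>M nonneg_bids)}"

primrec history :: "bidder \<Rightarrow> real \<Rightarrow> (nat \<Rightarrow> slot) \<Rightarrow> nat \<Rightarrow> history" where
  "history B r \<omega> 0 = (\<lambda>_. undefined)"
| "history B r \<omega> (Suc t) =
     (let b = snd B t r (history B r \<omega> t) (slot_value (\<omega> t))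
      in (history B r \<omega> t)(t := (slot_value (\<omega> t), alloc (\<omega> t) b, payment (\<omega> t) b)))"

definition bid :: "bidder \<Rightarrow> real \<Rightarrow> (nat \<Rightarrow> slot) \<Rightarrow> nat \<Rightarrow> real" where
  "bid B r \<omega> t = snd B t r (history B r \<omega> t) (slot_value (\<omega> t))"

definition outcome_space :: "bidder \<Rightarrow> slot measure \<Rightarrow> nat \<Rightarrow> (real \<times> (nat \<Rightarrow> slot)) measure" where
  "outcome_space B D T = fst B \<Otimes>\<^sub>M (\<Pi>\<^sub>M t\<in>{..<T}. D)"

definition expected_value :: "bidder \<Rightarrow> slot measure \<Rightarrow> nat \<Rightarrow> real" where
  "expected_value B D T =
     (\<integral>(r, \<omega>). (\<Sum>t<T. slot_value (\<omega> t) * alloc (\<omega> t) (bid B r \<omega> t)) \<partial>outcome_space B D T)"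

definition expected_payment :: "bidder \<Rightarrow> slot measure \<Rightarrow> nat \<Rightarrow> real" where
  "expected_payment B D T =
     (\<integral>(r, \<omega>). (\<Sum>t<T. payment (\<omega> t) (bid B r \<omega> t)) \<partial>outcome_space B D T)"

definition satisfies_ROSC :: "bidder \<Rightarrow> slot measure \<Rightarrow> nat \<Rightarrow> bool" where
  "satisfies_ROSC B D T \<longleftrightarrow> expected_payment B D T \<le> expected_value B D T"

definition strictly_satisfies_ROSC :: "bidder \<Rightarrow> nat \<Rightarrow> bool" where
  "strictly_satisfies_ROSC B T \<longleftrightarrow> (\<forall>D\<in>input_distributions. satisfies_ROSC B D T)"


section \<open>Benchmark and regret\<close>

text \<open>The benchmark may choose its algorithm depending on \<open>D\<close>, and only has to meet the constraint
  under that \<open>D\<close>.  Both suprema below are over nonempty sets of reals that are bounded above by \<open>T\<close>.\<close>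

definition OPT_value :: "slot measure \<Rightarrow> nat \<Rightarrow> real" where
  "OPT_value D T = (SUP B\<in>{B\<in>online_algorithms. satisfies_ROSC B D T}. expected_value B D T)"

definition regret :: "bidder \<Rightarrow> nat \<Rightarrow> real" where
  "regret B T = (SUP D\<in>input_distributions. OPT_value D T - expected_value B D T)"

end

theory Submission
  imports Defs
begin

text \<open>
  Let every slot have value \<open>1/2\<close> and be won exactly by the bids \<open>b \<ge> 3/4\<close>, at price \<open>c\<close>.
  If \<open>c = 3/4\<close>, every win violates the constraint, so an algorithm that satisfies it for all inputs
  almost surely never bids \<open>3/4\<close> or more.  A losing bid reveals nothing about \<open>c\<close>, so the algorithm
  behaves in the same way when \<open>c = 1/4\<close> and gets value \<open>0\<close>, although bidding \<open>3/4\<close> in every slot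
  is feasible there and has value \<open>T/2\<close>.
\<close>

section \<open>Bids and histories\<close>

text \<open>The typing of a policy constrains its bids only on the history space, so this membership
  is what makes every bid nonnegative. It holds because the recursion starts from the everywhere
  \<open>undefined\<close> function and updates only slots before \<open>t\<close>.\<close>

lemma history_in_space: "history B r \<omega> t \<in> space (history_space t)"
  by (induction t) (auto simp: history_space_def space_PiM PiE_def extensional_def Let_def)

lemma bid_nonneg:
  assumes "B \<in> online_algorithms"
  shows "bid B r \<omega> t \<ge> 0"
proof -
  obtain R \<pi> where B: "B = (R, \<pi>)" by (cases B)
  have R: "sets R = sets borel"
    and m: "(\<lambda>(r, h, v). \<pi> t r h v) \<in> R \<Otimes>\<^sub>M history_space t \<Otimes>\<^sub>M borel \<rightarrow>\<^sub>M nonneg_bids"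
    using assms by (auto simp: online_algorithms_def B)
  have "(r, history B r \<omega> t, slot_value (\<omega> t)) \<in> space (R \<Otimes>\<^sub>M history_space t \<Otimes>\<^sub>M borel)"
    using sets_eq_imp_space_eq[OF R] history_in_space by (simp add: space_pair_measure)
  from measurable_space[OF m this] show ?thesis
    by (simp add: bid_def B nonneg_bids_def space_restrict_space)
qed

lemma history_Suc_bid:
  "history B r \<omega> (Suc t) = (history B r \<omega> t)
     (t := (slot_value (\<omega> t), alloc (\<omega> t) (bid B r \<omega> t), payment (\<omega> t) (bid B r \<omega> t)))"
  by (simp add: bid_def Let_def)

lemma history_cong:
  assumes "\<And>\<tau>. \<tau> < t \<Longrightarrow> \<omega> \<tau> = \<omega>' \<tau>"
  shows "history B r \<omega> t = history B r \<omega>' t"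
  using assms by (induction t) simp_all

lemma bid_cong:
  assumes "\<And>\<tau>. \<tau> \<le> t \<Longrightarrow> \<omega> \<tau> = \<omega>' \<tau>"
  shows "bid B r \<omega> t = bid B r \<omega>' t"
  using assms history_cong[of t \<omega> \<omega>'] by (simp add: bid_def)

section \<open>Measurability in the seed, for a fixed sequence of slots\<close>

lemma measurable_bid_of_history:
  assumes "B \<in> online_algorithms"
    and h: "(\<lambda>r. history B r \<omega> t) \<in> fst B \<rightarrow>\<^sub>M history_space t"
  shows "(\<lambda>r. bid B r \<omega> t) \<in> fst B \<rightarrow>\<^sub>M nonneg_bids"
proof -
  obtain R \<pi> where B: "B = (R, \<pi>)" by (cases B)
  have m: "(\<lambda>(r, h, v). \<pi> t r h v) \<in> R \<Otimes>\<^sub>M history_space t \<Otimes>\<^sub>M borel \<rightarrow>\<^sub>M nonneg_bids"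
    using assms by (auto simp: online_algorithms_def B)
  have "(\<lambda>r. (r, history B r \<omega> t, slot_value (\<omega> t))) \<in> R \<rightarrow>\<^sub>M R \<Otimes>\<^sub>M history_space t \<Otimes>\<^sub>M borel"
    using h by (simp add: B)
  from measurable_compose[OF this m] show ?thesis
    by (simp add: bid_def B)
qed

text \<open>Bids and histories become measurable in alternation: a measurable history yields a
  measurable bid through the policy, and the bid yields the next history through the measurable
  allocation and payment.\<close>

lemma measurable_history:
  assumes "B \<in> online_algorithms"
    and "\<And>t. alloc (\<omega> t) \<in> borel_measurable nonneg_bids"
    and "\<And>t. payment (\<omega> t) \<in> borel_measurable nonneg_bids"
  shows "(\<lambda>r. history B r \<omega> t) \<in> fst B \<rightarrow>\<^sub>M history_space t"
proof (induction t)
  case 0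
  show ?case by (simp add: history_space_def space_PiM)
next
  case (Suc t)
  note [measurable] = measurable_bid_of_history[OF assms(1) Suc] assms(2,3)
  show ?case
    unfolding history_Suc_bid history_space_def
  proof (rule measurable_fun_upd[where J = "{..<t}"])
    show "(\<lambda>r. history B r \<omega> t) \<in> fst B \<rightarrow>\<^sub>M (\<Pi>\<^sub>M \<tau>\<in>{..<t}. borel)"
      using Suc by (simp add: history_space_def)
  qed auto
qed

lemma measurable_bid:
  assumes "B \<in> online_algorithms"
    and "\<And>t. alloc (\<omega> t) \<in> borel_measurable nonneg_bids"
    and "\<And>t. payment (\<omega> t) \<in> borel_measurable nonneg_bids"
  shows "(\<lambda>r. bid B r \<omega> t) \<in> fst B \<rightarrow>\<^sub>M nonneg_bids"
  using assms by (intro measurable_bid_of_history measurable_history)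

section \<open>Boundedness of the expected value\<close>

lemma slot_value_times_alloc:
  assumes "valid_slot s" "b \<ge> 0"
  shows "slot_value s * alloc s b \<in> {0..1}"
  using assms by (auto simp: valid_slot_def Pi_iff mult_le_one)

lemma prob_space_outcome_space:
  assumes "B \<in> online_algorithms" "prob_space D"
  shows "prob_space (outcome_space B D T)"
proof -
  interpret R: prob_space "fst B" using assms by (auto simp: online_algorithms_def)
  interpret P: prob_space "\<Pi>\<^sub>M t\<in>{..<T}. D" by (rule prob_space_PiM) (rule assms)
  interpret PP: pair_prob_space "fst B" "\<Pi>\<^sub>M t\<in>{..<T}. D" ..
  show ?thesis unfolding outcome_space_def by (rule PP.prob_space_axioms)
qed

lemma expected_value_bounds:
  assumes "B \<in> online_algorithms" "D \<in> input_distributions"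
  shows "expected_value B D T \<in> {0..real T}"
proof -
  have D: "prob_space D" "\<And>s. s \<in> space D \<Longrightarrow> valid_slot s"
    using assms by (auto simp: input_distributions_def)
  interpret prob_space "outcome_space B D T"
    by (rule prob_space_outcome_space[OF assms(1) D(1)])
  let ?f = "\<lambda>(r, \<omega>). \<Sum>t<T. slot_value (\<omega> t) * alloc (\<omega> t) (bid B r \<omega> t)"
  have bounds: "?f z \<in> {0..real T}" if "z \<in> space (outcome_space B D T)" for z
  proof -
    obtain r \<omega> where z: "z = (r, \<omega>)" by (cases z)
    have "slot_value (\<omega> t) * alloc (\<omega> t) (bid B r \<omega> t) \<in> {0..1}" if "t < T" for t
      using \<open>z \<in> _\<close> that
      by (intro slot_value_times_alloc D(2) bid_nonneg assms(1))
        (auto simp: z outcome_space_def space_pair_measure space_PiM)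
    hence "0 \<le> ?f z" "?f z \<le> (\<Sum>t<T. 1)"
      unfolding z prod.case by (intro sum_nonneg sum_mono; simp)+
    thus ?thesis by simp
  qed
  have "expected_value B D T = integral\<^sup>L (outcome_space B D T) ?f"
    by (simp add: expected_value_def)
  moreover have "integral\<^sup>L (outcome_space B D T) ?f \<ge> 0"
    using bounds by (intro Bochner_Integration.integral_nonneg) simp
  moreover have "integral\<^sup>L (outcome_space B D T) ?f \<le> real T"
  \<comment> \<open>The pointwise bound carries over to an integrable function; otherwise the
    Bochner integral is 0 by convention, which is within the bound too.\<close>
  proof (cases "integrable (outcome_space B D T) ?f")
    case True
    thus ?thesis using bounds by (intro integral_le_const) auto
  next
    case False
    thus ?thesis by (simp add: not_integrable_integral_eq)
  qed
  ultimately show ?thesis by simp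
qed

section \<open>Constant bids and the benchmark\<close>

text \<open>A deterministic algorithm as a \<open>bidder\<close>: the policy ignores its seed, whose
  law is a point mass.\<close>

definition constant_bidder :: "real \<Rightarrow> bidder" where
  "constant_bidder b = (return borel 0, \<lambda>_ _ _ _. b)"

lemma constant_bidder_online: "b \<ge> 0 \<Longrightarrow> constant_bidder b \<in> online_algorithms"
  by (auto simp: constant_bidder_def online_algorithms_def nonneg_bids_def space_restrict_space
      intro!: prob_space_return)

lemma bid_constant_bidder [simp]: "bid (constant_bidder b) r \<omega> t = b"
  by (simp add: bid_def constant_bidder_def)

text \<open>A zero bid wins nothing and pays nothing, so both sides of the constraint agree. This
  keeps the feasible set of the benchmark nonempty for every input.\<close>

lemma constant_bidder_0_ROSC:
  assumes "D \<in> input_distributions"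
  shows "satisfies_ROSC (constant_bidder 0) D T"
proof -
  have 0: "alloc s 0 = 0" "payment s 0 = 0" if "s \<in> space D" for s
    using assms that by (auto simp: input_distributions_def valid_slot_def)
  have "expected_payment (constant_bidder 0) D T = expected_value (constant_bidder 0) D T"
    unfolding expected_payment_def expected_value_def
  proof (intro Bochner_Integration.integral_cong refl, clarify, intro sum.cong refl)
    fix r \<omega> t
    assume "(r, \<omega>) \<in> space (outcome_space (constant_bidder 0) D T)" "t \<in> {..<T}"
    hence "\<omega> t \<in> space D"
      by (auto simp: outcome_space_def space_pair_measure space_PiM)
    thus "payment (\<omega> t) (bid (constant_bidder 0) r \<omega> t)
        = slot_value (\<omega> t) * alloc (\<omega> t) (bid (constant_bidder 0) r \<omega> t)"
      by (simp add: 0)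
  qed
  thus ?thesis by (simp add: satisfies_ROSC_def)
qed

section \<open>Benchmark and regret as suprema of bounded sets\<close>

lemma expected_value_le_OPT:
  assumes "B \<in> online_algorithms" "D \<in> input_distributions" "satisfies_ROSC B D T"
  shows "expected_value B D T \<le> OPT_value D T"
  unfolding OPT_value_def using assms expected_value_bounds[OF _ assms(2), where T = T]
  by (intro cSUP_upper bdd_aboveI2[where M = "real T"]) auto

lemma OPT_value_le:
  assumes "D \<in> input_distributions"
  shows "OPT_value D T \<le> real T"
  unfolding OPT_value_def
proof (rule cSUP_least)
  show "{B \<in> online_algorithms. satisfies_ROSC B D T} \<noteq> {}"
    using constant_bidder_online[of 0] constant_bidder_0_ROSC[OF assms] by blast
qed (use expected_value_bounds[OF _ assms] in auto)

text \<open>A real supremum dominates its members only over a bounded family; here \<open>T\<close>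
  is a bound, since the benchmark is at most \<open>T\<close> and the algorithm's value is
  nonnegative.\<close>

lemma regret_ge:
  assumes "B \<in> online_algorithms" "D \<in> input_distributions"
  shows "OPT_value D T - expected_value B D T \<le> regret B T"
  unfolding regret_def
proof (rule cSUP_upper)
  have "OPT_value D T - expected_value B D T \<le> real T" if "D \<in> input_distributions" for D
    using OPT_value_le[OF that, of T] expected_value_bounds[OF assms(1) that, of T] by auto
  thus "bdd_above ((\<lambda>D. OPT_value D T - expected_value B D T) ` input_distributions)"
    by (intro bdd_aboveI2)
qed (rule assms)

section \<open>Deterministic inputs\<close>

text \<open>The underlying space is only \<open>{s}\<close>, since every point of an input distribution has to be
  a valid slot.\<close>

definition point_input :: "slot \<Rightarrow> slot measure" where
  "point_input s = return (count_space {s}) s"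

lemma space_point_input [simp]: "space (point_input s) = {s}"
  by (simp add: point_input_def)

lemma prob_space_point_input: "prob_space (point_input s)"
  unfolding point_input_def by (rule prob_space_return) simp

text \<open>The slot coordinate takes a single value, so joint measurability reduces to
  measurability in the bid alone.\<close>

lemma measurable_point_input_pair:
  assumes "f s \<in> M \<rightarrow>\<^sub>M N"
  shows "(\<lambda>(s, b). f s b) \<in> point_input s \<Otimes>\<^sub>M M \<rightarrow>\<^sub>M N"
proof -
  have "(\<lambda>z. f s (snd z)) \<in> point_input s \<Otimes>\<^sub>M M \<rightarrow>\<^sub>M N"
    using assms by measurable
  thus ?thesis
    by (rule measurable_cong[THEN iffD1, rotated]) (auto simp: space_pair_measure)
qed

lemma point_input_in_input_distributions:
  assumes "valid_slot s"
    and "alloc s \<in> borel_measurable nonneg_bids" "payment s \<in> borel_measurable nonneg_bids"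
  shows "point_input s \<in> input_distributions"
proof -
  have "slot_value \<in> borel_measurable (point_input s)"
    by (simp add: point_input_def)
  thus ?thesis
    unfolding input_distributions_def
    by (intro CollectI conjI prob_space_point_input measurable_point_input_pair assms(2,3))
      (use assms(1) in simp_all)
qed

text \<open>Every slot sequence in the outcome space is constantly \<open>s\<close> before
  \<open>T\<close>, so the integrand depends on the seed only, and the seed marginal of the product
  is \<open>fst B\<close>.\<close>

lemma integral_outcome_space_point_input:
  fixes f :: "slot \<Rightarrow> real \<Rightarrow> real"
  assumes B: "B \<in> online_algorithms"
    and s: "alloc s \<in> borel_measurable nonneg_bids" "payment s \<in> borel_measurable nonneg_bids"
    and f: "f s \<in> borel_measurable nonneg_bids"
  shows "(\<integral>(r, \<omega>). (\<Sum>t<T. f (\<omega> t) (bid B r \<omega> t)) \<partial>outcome_space B (point_input s) T)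
       = (\<integral>r. (\<Sum>t<T. f s (bid B r (\<lambda>_. s) t)) \<partial>fst B)"
proof -
  let ?P = "\<Pi>\<^sub>M t\<in>{..<T}. point_input s"
  let ?g = "\<lambda>r. \<Sum>t<T. f s (bid B r (\<lambda>_. s) t)"
  note [measurable] = measurable_bid[where \<omega> = "\<lambda>_. s", OF B s] f
  interpret P: prob_space ?P by (rule prob_space_PiM) (rule prob_space_point_input)
  have g: "?g \<in> borel_measurable (fst B)" by measurable
  have "(\<integral>(r, \<omega>). (\<Sum>t<T. f (\<omega> t) (bid B r \<omega> t)) \<partial>outcome_space B (point_input s) T)
      = (\<integral>z. ?g (fst z) \<partial>(fst B \<Otimes>\<^sub>M ?P))"
    unfolding outcome_space_def
  proof (intro Bochner_Integration.integral_cong refl, clarsimp, intro sum.cong refl)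
    fix r \<omega> t assume z: "(r, \<omega>) \<in> space (fst B \<Otimes>\<^sub>M ?P)" and t: "t \<in> {..<T}"
    have "\<omega> \<tau> = s" if "\<tau> < T" for \<tau>
      \<comment> \<open>As the space of \<open>point_input s\<close> is a singleton, this holds
        everywhere and not just almost everywhere.\<close>
      using z that by (auto simp: space_pair_measure space_PiM PiE_iff)
    thus "f (\<omega> t) (bid B r \<omega> t) = f s (bid B r (\<lambda>_. s) t)"
      using t bid_cong[of t \<omega> "\<lambda>_. s"] by simp
  qed
  also have "\<dots> = integral\<^sup>L (distr (fst B \<Otimes>\<^sub>M ?P) (fst B) fst) ?g"
    using g by (subst integral_distr) auto
  also have "distr (fst B \<Otimes>\<^sub>M ?P) (fst B) fst = fst B"
    by (rule P.distr_pair_fst)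
  finally show ?thesis .
qed

section \<open>Two indistinguishable inputs\<close>

text \<open>The threshold 3/4 lies above the value 1/2, which leaves room for a price
  \<open>c\<close> above the value that still does not exceed any winning bid.\<close>

definition threshold_slot :: "real \<Rightarrow> slot" where
  "threshold_slot c =
     (1/2, \<lambda>b. if b < 3/4 then 0 else 1, \<lambda>b. if b < 3/4 then 0 else c)"

lemma threshold_slot_simps [simp]:
  "slot_value (threshold_slot c) = 1/2"
  "alloc (threshold_slot c) b = (if b < 3/4 then 0 else 1)"
  "payment (threshold_slot c) b = (if b < 3/4 then 0 else c)"
  by (simp_all add: threshold_slot_def slot_value_def alloc_def payment_def)

lemma threshold_slot_measurable:
  "alloc (threshold_slot c) \<in> borel_measurable nonneg_bids"
  "payment (threshold_slot c) \<in> borel_measurable nonneg_bids"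
proof -
  have [measurable]: "(\<lambda>b. b) \<in> borel_measurable nonneg_bids"
    by (simp add: nonneg_bids_def measurable_restrict_space1)
  have "(\<lambda>b. alloc (threshold_slot c) b) \<in> borel_measurable nonneg_bids"
    "(\<lambda>b. payment (threshold_slot c) b) \<in> borel_measurable nonneg_bids"
    unfolding threshold_slot_simps by measurable
  thus "alloc (threshold_slot c) \<in> borel_measurable nonneg_bids"
    "payment (threshold_slot c) \<in> borel_measurable nonneg_bids" .
qed

lemma valid_threshold_slot:
  assumes "0 \<le> c" "c \<le> 3/4"
  shows "valid_slot (threshold_slot c)"
  unfolding valid_slot_def
  \<comment> \<open>The allocation is 0 or 1 and the payment vanishes where it is 0, so the payment
    itself serves as the per-win price \<open>q\<close>.\<close>
  by (intro conjI exI[of _ "payment (threshold_slot c)"])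
    (use assms in \<open>auto simp: mono_on_def\<close>)

lemma threshold_input:
  assumes "0 \<le> c" "c \<le> 3/4"
  shows "point_input (threshold_slot c) \<in> input_distributions"
  using assms
  by (intro point_input_in_input_distributions valid_threshold_slot threshold_slot_measurable)

lemma expected_value_threshold:
  assumes "B \<in> online_algorithms"
  shows "expected_value B (point_input (threshold_slot c)) T =
    (\<integral>r. (\<Sum>t<T. 1/2 * alloc (threshold_slot c) (bid B r (\<lambda>_. threshold_slot c) t)) \<partial>fst B)"
  unfolding expected_value_def
  using threshold_slot_measurable(1)[of c]
  by (subst integral_outcome_space_point_input[OF assms threshold_slot_measurable,
        where f = "\<lambda>s b. slot_value s * alloc s b"]) (auto simp del: threshold_slot_simps(2))

lemma expected_payment_threshold:
  assumes "B \<in> online_algorithms"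
  shows "expected_payment B (point_input (threshold_slot c)) T =
    (\<integral>r. (\<Sum>t<T. payment (threshold_slot c) (bid B r (\<lambda>_. threshold_slot c) t)) \<partial>fst B)"
  unfolding expected_payment_def
  using threshold_slot_measurable(2)[of c]
  by (rule integral_outcome_space_point_input[OF assms threshold_slot_measurable])

text \<open>A losing bid is answered by (1/2, 0, 0) at every price. Low bids are assumed for price
  \<open>c\<close> only: equal histories force equal bids, which carries the induction over to price
  \<open>d\<close>.\<close>

lemma history_threshold_slot_cong:
  assumes "\<And>\<tau>. \<tau> < t \<Longrightarrow> bid B r (\<lambda>_. threshold_slot c) \<tau> < 3/4"
  shows "history B r (\<lambda>_. threshold_slot d) t = history B r (\<lambda>_. threshold_slot c) t"
  using assms
proof (induction t)
  case (Suc t)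
  hence "history B r (\<lambda>_. threshold_slot d) t = history B r (\<lambda>_. threshold_slot c) t"
    by simp
  hence "bid B r (\<lambda>_. threshold_slot d) t = bid B r (\<lambda>_. threshold_slot c) t"
    by (simp add: bid_def)
  with Suc show ?case by (simp only: history_Suc_bid) simp
qed simp

text \<open>With \<open>?W\<close> the number of wins, the constraint reads 3/4 E[\<open>?W\<close>]
  \<le> 1/2 E[\<open>?W\<close>]. Hence the nonnegative variable \<open>?W\<close> has mean 0 and
  vanishes almost surely.\<close>

lemma overpriced_never_won:
  assumes B: "B \<in> online_algorithms" and "strictly_satisfies_ROSC B T"
  shows "AE r in fst B. \<forall>t<T. bid B r (\<lambda>_. threshold_slot (3/4)) t < 3/4"
proof -
  let ?s = "threshold_slot (3/4)"
  let ?W = "\<lambda>r. \<Sum>t<T. alloc ?s (bid B r (\<lambda>_. ?s) t)"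
  interpret R: prob_space "fst B" using B by (auto simp: online_algorithms_def)
  have W_meas: "?W \<in> borel_measurable (fst B)"
    by (intro borel_measurable_sum measurable_compose[OF
          measurable_bid[where \<omega> = "\<lambda>_. ?s", OF B threshold_slot_measurable]
          threshold_slot_measurable(1)])
  have "norm (?W r) \<le> real T" for r
    using sum_mono[of "{..<T}" "\<lambda>t. alloc ?s (bid B r (\<lambda>_. ?s) t)" "\<lambda>_. 1"]
    by (simp add: sum_nonneg)
  hence W_int: "integrable (fst B) ?W"
    by (intro R.integrable_const_bound[where B = "real T"] W_meas) auto
  have "expected_payment B (point_input ?s) T \<le> expected_value B (point_input ?s) T"
    using assms threshold_input[of "3/4"]
    by (simp add: strictly_satisfies_ROSC_def satisfies_ROSC_def)
  \<comment> \<open>This turns payment and value into multiples of the same random variable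
    \<open>?W\<close>.\<close>
  moreover have "payment ?s b = 3/4 * alloc ?s b" for b
    by simp
  ultimately have "(\<integral>r. 3/4 * ?W r \<partial>fst B) \<le> (\<integral>r. 1/2 * ?W r \<partial>fst B)"
    unfolding expected_payment_threshold[OF B] expected_value_threshold[OF B]
    by (simp only: sum_distrib_left)
  hence "3/4 * (\<integral>r. ?W r \<partial>fst B) \<le> 1/2 * (\<integral>r. ?W r \<partial>fst B)"
    by (simp only: integral_mult_right_zero)
  moreover have "(\<integral>r. ?W r \<partial>fst B) \<ge> 0"
    by (intro Bochner_Integration.integral_nonneg sum_nonneg) simp
  ultimately have "(\<integral>r. ?W r \<partial>fst B) = 0" by linarith
  hence "AE r in fst B. ?W r = 0"
    by (subst (asm) integral_nonneg_eq_0_iff_AE[OF W_int]) (auto intro!: AE_I2 sum_nonneg)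
  thus ?thesis
  proof (rule AE_mp, intro AE_I2 impI allI)
    fix r t assume W: "?W r = 0" and "t < T"
    hence "alloc ?s (bid B r (\<lambda>_. ?s) t) = 0"
      by (subst (asm) sum_nonneg_eq_0_iff) auto
    thus "bid B r (\<lambda>_. ?s) t < 3/4" by (simp split: if_splits)
  qed
qed

text \<open>For almost every seed all bids at price 3/4 lose; for such a seed the bids at price
  \<open>c\<close> are the same and lose as well.\<close>

lemma strict_ROSC_threshold_value_0:
  assumes B: "B \<in> online_algorithms" and "strictly_satisfies_ROSC B T"
  shows "expected_value B (point_input (threshold_slot c)) T = 0"
proof -
  have "AE r in fst B.
      (\<Sum>t<T. 1/2 * alloc (threshold_slot c) (bid B r (\<lambda>_. threshold_slot c) t)) = 0"
    using overpriced_never_won[OF assms]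
  proof (rule AE_mp, intro AE_I2 impI sum.neutral ballI)
    fix r t assume low: "\<forall>t<T. bid B r (\<lambda>_. threshold_slot (3/4)) t < 3/4" and t: "t \<in> {..<T}"
    have "bid B r (\<lambda>_. threshold_slot c) t = bid B r (\<lambda>_. threshold_slot (3/4)) t"
      using low t history_threshold_slot_cong[of t B r "3/4" c] by (simp add: bid_def)
    with low t show "1/2 * alloc (threshold_slot c) (bid B r (\<lambda>_. threshold_slot c) t) = 0"
      by simp
  qed
  thus ?thesis
    unfolding expected_value_threshold[OF B] by (rule integral_eq_zero_AE)
qed

text \<open>Bidding 3/4 throughout wins every slot, for value \<open>T\<close>/2 and spend
  \<open>T * c\<close>; the bound \<open>c\<close> \<le> 1/2 makes this feasible.\<close>

lemma OPT_value_threshold_ge: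
  assumes "0 \<le> c" "c \<le> 1/2"
  shows "OPT_value (point_input (threshold_slot c)) T \<ge> real T / 2"
proof -
  let ?B = "constant_bidder (3/4)"
  have B: "?B \<in> online_algorithms" by (simp add: constant_bidder_online)
  interpret R: prob_space "fst ?B" using B by (auto simp: online_algorithms_def)
  have val: "expected_value ?B (point_input (threshold_slot c)) T = real T / 2"
    by (simp add: expected_value_threshold[OF B] R.prob_space)
  moreover have "expected_payment ?B (point_input (threshold_slot c)) T = real T * c"
    by (simp add: expected_payment_threshold[OF B] R.prob_space)
  moreover have "real T * c \<le> real T / 2"
    using assms mult_left_mono[of c "1/2" "real T"] by simp
  ultimately have "satisfies_ROSC ?B (point_input (threshold_slot c)) T"
    by (simp add: satisfies_ROSC_def)
  from expected_value_le_OPT[OF B threshold_input this] val assms show ?thesis by simp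
qed

theorem theorem5:
  fixes A :: "nat \<Rightarrow> bidder"
  assumes "\<And>T. A T \<in> online_algorithms"
    and "\<And>T. strictly_satisfies_ROSC (A T) T"
  shows "(\<lambda>T. regret (A T) T) \<in> \<Omega>(\<lambda>T. real T)"
proof (rule landau_omega.bigI[of "1/2"])
  \<comment> \<open>Any price in [0, 1/2] would do; the same input serves all horizons.\<close>
  let ?D = "point_input (threshold_slot (1/4))"
  have D: "?D \<in> input_distributions"
    by (rule threshold_input) simp_all
  have "real T / 2 \<le> regret (A T) T" for T
  proof -
    have "expected_value (A T) ?D T = 0"
      by (rule strict_ROSC_threshold_value_0[OF assms])
    moreover have "real T / 2 \<le> OPT_value ?D T"
      by (rule OPT_value_threshold_ge) simp_all
    moreover have "OPT_value ?D T - expected_value (A T) ?D T \<le> regret (A T) T"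
      by (rule regret_ge[OF assms(1) D])
    ultimately show ?thesis by linarith
  qed
  from order_trans[OF this abs_ge_self]
  have "norm (regret (A T) T) \<ge> 1/2 * norm (real T)" for T
    by simp
  thus "\<forall>\<^sub>F T in sequentially. norm (regret (A T) T) \<ge> 1/2 * norm (real T)"
    by (rule always_eventually[OF allI])
qed simp

end
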